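(* For every positive integer $k$, $$3\left\lceil \frac{3}{4}k\right\rceil -2\le m_{\mathcal{A}^+}(k)\le 4k-3.$$
   Context: The family $\mathcal{A}^+$ consists of hypergraphs $H=(V,E)$ with $V\subset\mathbb{R}^2$ finite and every edge of the form $V\cap\big(\{(x,y): y_0<y<y_1\}\cup\{(x,y): x_0<x<x_1\}\big)$ for some reals $x_0,x_1,y_0,y_1$ (union of a horizontal and a vertical strip). A polychromatic $k$-coloring of a hypergraph is a coloring of its vertices with $k$ colors such that every edge contains a vertex of each color. $H_{\ge m}$ is obtained from $H$ by deleting all edges of size less than $m$. For a hypergraph family $\mathcal{H}$, $m_{\mathcal{H}}(k)$ is the smallest positive integer $m$ such that $H_{\ge m}$ has a polychromatic $k$-coloring for every $H\in\mathcal{H}$ ($\infty$ if none exists). *)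

theory Defs
  imports Complex_Main "HOL-Library.Extended_Nat" "HOL-Library.FuncSet"
begin

text \<open>A hypergraph is a pair of a vertex set and a set of edges. Edge sizes are measured with
  \<^const>\<open>card\<close>, so the notions below are meant for finite vertex sets.\<close>

type_synonym 'a hypergraph = "'a set \<times> 'a set set"

definition restrict_edges :: "nat \<Rightarrow> 'a hypergraph \<Rightarrow> 'a hypergraph" where
  "restrict_edges m H = (fst H, {e \<in> snd H. m \<le> card e})"

definition polychromatic_coloring :: "nat \<Rightarrow> 'a hypergraph \<Rightarrow> ('a \<Rightarrow> nat) \<Rightarrow> bool" where
  "polychromatic_coloring k H c \<longleftrightarrow>
     c \<in> fst H \<rightarrow> {..<k} \<and> (\<forall>e \<in> snd H. \<forall>i<k. \<exists>v\<in>e. c v = i)"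

definition polychromatic_bound :: "'a hypergraph set \<Rightarrow> nat \<Rightarrow> nat \<Rightarrow> bool" where
  "polychromatic_bound \<H> k m \<longleftrightarrow>
     m > 0 \<and> (\<forall>H\<in>\<H>. \<exists>c. polychromatic_coloring k (restrict_edges m H) c)"

definition polychromatic_number :: "'a hypergraph set \<Rightarrow> nat \<Rightarrow> enat" where
  "polychromatic_number \<H> k =
     (if \<exists>m. polychromatic_bound \<H> k m then enat (LEAST m. polychromatic_bound \<H> k m) else \<infinity>)"

definition horizontal_strip :: "real \<Rightarrow> real \<Rightarrow> (real \<times> real) set" where
  "horizontal_strip y\<^sub>0 y\<^sub>1 = {(x, y). y\<^sub>0 < y \<and> y < y\<^sub>1}"

definition vertical_strip :: "real \<Rightarrow> real \<Rightarrow> (real \<times> real) set" where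
  "vertical_strip x\<^sub>0 x\<^sub>1 = {(x, y). x\<^sub>0 < x \<and> x < x\<^sub>1}"

text \<open>The edge set may be any collection of traces of unions of two strips, not
  necessarily all of them.\<close>

definition strip_union_family :: "(real \<times> real) hypergraph set" where
  "strip_union_family = {(V, E). finite V \<and>
     (\<forall>e\<in>E. \<exists>x\<^sub>0 x\<^sub>1 y\<^sub>0 y\<^sub>1. e = V \<inter> (horizontal_strip y\<^sub>0 y\<^sub>1 \<union> vertical_strip x\<^sub>0 x\<^sub>1))}"

end

theory Submission
  imports Defs
begin

text \<open>Upper bound: an edge with at least \<open>4k - 3\<close> points has at least \<open>2k - 1\<close> points in one of its
  two strips. Cut the points into blocks of \<open>k\<close> consecutive ones, once from left to right and once
  from bottom to top. Regarding each point as an edge between its two blocks gives a bipartite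
  multigraph of maximum degree \<open>k\<close>, and in a proper \<open>k\<close>-edge-colouring every full block has all
  colours; a strip with \<open>2k - 1\<close> points contains a full block.

  Lower bound: take eight groups of \<open>p = \<lceil>3k/4\<rceil> - 1\<close> points. A group misses more than \<open>k/4\<close> colours,
  so some colour is missed by three groups. The groups are arranged so that any three of them
  include two that form a strip, and the third is a strip of the other direction; their union
  is an edge of size \<open>3p\<close> without that colour.\<close>

section \<open>Edge colouring of bipartite multigraphs\<close>

text \<open>A bipartite multigraph is given by its edge set \<open>V\<close> and the two maps \<open>f\<close>, \<open>g\<close> sending an
  edge to its ends.\<close>

definition proper_on :: "'a set \<Rightarrow> ('a \<Rightarrow> 'b) \<Rightarrow> ('a \<Rightarrow> 'c) \<Rightarrow> bool" where
  "proper_on V f c \<longleftrightarrow> (\<forall>u\<in>V. \<forall>v\<in>V. u \<noteq> v \<and> f u = f v \<longrightarrow> c u \<noteq> c v)"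

definition degree_le :: "nat \<Rightarrow> 'a set \<Rightarrow> ('a \<Rightarrow> 'b) \<Rightarrow> bool" where
  "degree_le k V f \<longleftrightarrow> (\<forall>j. card {v\<in>V. f v = j} \<le> k)"

lemma degree_le_subset:
  assumes "degree_le k V f" "finite V" "U \<subseteq> V"
  shows "degree_le k U f"
  unfolding degree_le_def
proof
  fix j
  have "card {v\<in>U. f v = j} \<le> card {v\<in>V. f v = j}"
    using assms by (intro card_mono) auto
  then show "card {v\<in>U. f v = j} \<le> k"
    using assms(1) unfolding degree_le_def by (meson order_trans)
qed

text \<open>Turns the degree bound into pigeonhole on three named edges, the form in which the
  two-colour case uses it.\<close>

lemma degree_le_2_iff:
  assumes "finite V"
  shows "degree_le 2 V f \<longleftrightarrow>
    (\<forall>u\<in>V. \<forall>v\<in>V. \<forall>w\<in>V. f u = f v \<and> f v = f w \<longrightarrow> u = v \<or> v = w \<or> u = w)"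
    (is "_ \<longleftrightarrow> ?R")
proof
  assume d: "degree_le 2 V f"
  show ?R
  proof (intro ballI impI, rule ccontr)
    fix u v w
    assume *: "u \<in> V" "v \<in> V" "w \<in> V" "f u = f v \<and> f v = f w" "\<not> (u = v \<or> v = w \<or> u = w)"
    have "card {u, v, w} \<le> card {x\<in>V. f x = f u}"
      using * assms by (intro card_mono) auto
    moreover have "card {x\<in>V. f x = f u} \<le> 2" using d unfolding degree_le_def by blast
    ultimately show False using * by auto
  qed
next
  assume R: ?R
  show "degree_le 2 V f"
    unfolding degree_le_def
  proof (intro allI, rule ccontr)
    fix j
    assume "\<not> card {v\<in>V. f v = j} \<le> 2"
    then have "3 \<le> card {v\<in>V. f v = j}" by simp
    then obtain T where T: "T \<subseteq> {v\<in>V. f v = j}" "card T = 3"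
      by (meson obtain_subset_with_card_n)
    then obtain u v w where "T = {u, v, w}" "u \<noteq> v" "v \<noteq> w" "u \<noteq> w"
      by (auto simp: card_3_iff)
    then have "u \<in> V" "v \<in> V" "w \<in> V" "f u = f v \<and> f v = f w" using T(1) by auto
    with R have "u = v \<or> v = w \<or> u = w" by blast
    with \<open>u \<noteq> v\<close> \<open>v \<noteq> w\<close> \<open>u \<noteq> w\<close> show False by blast
  qed
qed

lemma proper_on_insert:
  "proper_on (insert e V) f c \<longleftrightarrow>
    proper_on V f c \<and> (\<forall>v\<in>V. v \<noteq> e \<and> f v = f e \<longrightarrow> c v \<noteq> c e)"
  unfolding proper_on_def by (auto; metis)

lemma proper_on_cong:
  assumes "proper_on V f c" "\<And>v. v \<in> V \<Longrightarrow> c v = c' v"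
  shows "proper_on V f c'"
  using assms unfolding proper_on_def by metis

text \<open>Two edges \<open>x\<close>, \<open>y\<close> meeting on the \<open>f\<close>-side are deleted and their ends on the \<open>g\<close>-side
  are identified; a colouring of the smaller graph extends to \<open>x\<close> and \<open>y\<close>.\<close>

lemma bipartite_two_edge_coloring:
  fixes f :: "'a \<Rightarrow> 'b" and g :: "'a \<Rightarrow> 'c"
  assumes "finite V" "degree_le 2 V f" "degree_le 2 V g"
  shows "\<exists>c :: 'a \<Rightarrow> bool. proper_on V f c \<and> proper_on V g c"
  using assms
proof (induction "card V" arbitrary: V f g rule: less_induct)
  case less
  note fin = less.prems(1)
  have f2: "u = v \<or> v = w \<or> u = w"
    if "u \<in> V" "v \<in> V" "w \<in> V" "f u = f v" "f v = f w" for u v w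
    using less.prems that by (auto simp: degree_le_2_iff)
  have g2: "u = v \<or> v = w \<or> u = w"
    if "u \<in> V" "v \<in> V" "w \<in> V" "g u = g v" "g v = g w" for u v w
    using less.prems that by (auto simp: degree_le_2_iff)
  show ?case
  proof (cases "\<exists>x\<in>V. \<exists>y\<in>V. x \<noteq> y \<and> f x = f y")
    case False
    \<comment> \<open>Here \<open>f\<close> is injective on \<open>V\<close>, so only
      \<open>g\<close> constrains the colouring. The chosen element depends on \<open>g v\<close>
      alone and singles out one edge at each end; the other edge there, if any, gets the opposite
      colour.\<close>
    define c where "c v \<longleftrightarrow> v = (SOME u. u \<in> V \<and> g u = g v)" for v
    have "c u \<noteq> c v" if uv: "u \<in> V" "v \<in> V" "u \<noteq> v" "g u = g v" for u v
    proof -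
      define s where "s = (SOME w. w \<in> V \<and> g w = g v)"
      have "s \<in> V \<and> g s = g v" unfolding s_def using uv by (metis (mono_tags, lifting) someI)
      then have "s = u \<or> s = v" using g2[of s u v] uv by auto
      then show ?thesis using uv unfolding c_def s_def by auto
    qed
    then have "proper_on V g c" unfolding proper_on_def by blast
    moreover have "proper_on V f c" using False unfolding proper_on_def by blast
    ultimately show ?thesis by blast
  next
    case True
    then obtain x y where xy: "x \<in> V" "y \<in> V" "x \<noteq> y" "f x = f y" by blast
    define W where "W = V - {x, y}"
    define h where "h v = (if g v = g y then g x else g v)" for v
    have W: "finite W" "W \<subseteq> V" "V = insert x (insert y W)" "x \<notin> W" "y \<notin> W"
      using fin xy unfolding W_def by auto
    have "card W < card V" using fin xy W by (intro psubset_card_mono) auto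
    moreover have "degree_le 2 W f" using less.prems W degree_le_subset by blast
    moreover have "degree_le 2 W h"
      unfolding degree_le_2_iff[OF W(1)]
    proof (intro ballI impI)
      fix u v w
      assume *: "u \<in> W" "v \<in> W" "w \<in> W" "h u = h v \<and> h v = h w"
      have V: "u \<in> V" "v \<in> V" "w \<in> V" using * W by auto
      \<comment> \<open>Besides \<open>x\<close> or \<open>y\<close> itself, each of the ends
        \<open>g x\<close> and \<open>g y\<close> carries at most one edge, so the merged end keeps
        degree at most 2.\<close>
      have un: "p = q" if "p \<in> W" "q \<in> W" "g p = g q" "g p = g x \<or> g p = g y" for p q
      proof -
        have "p \<in> V" "q \<in> V" "p \<noteq> x" "q \<noteq> x" "p \<noteq> y" "q \<noteq> y" using that(1,2) W by auto
        then show ?thesis using g2[of p q x] g2[of p q y] xy that(3,4) by auto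
      qed
      show "u = v \<or> v = w \<or> u = w"
      proof (cases "h u = g x")
        case True
        then have "g u \<in> {g x, g y}" "g v \<in> {g x, g y}" "g w \<in> {g x, g y}"
          using *(4) unfolding h_def by (auto split: if_splits)
        then show ?thesis using un[of u v] un[of v w] un[of u w] *(1-3) by auto
      next
        case False
        then have "g u = g v" "g v = g w" using *(4) unfolding h_def by (auto split: if_splits)
        then show ?thesis using g2 V by blast
      qed
    qed
    ultimately obtain d :: "'a \<Rightarrow> bool" where d: "proper_on W f d" "proper_on W h d"
      using less.hyps[of W f h] W(1) by blast
    have dh: "d u \<noteq> d v" if "u \<in> W" "v \<in> W" "u \<noteq> v" "h u = h v" for u v
      using d(2) that unfolding proper_on_def by blast
    \<comment> \<open>\<open>b\<close> is meant for \<open>x\<close> and its negation for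
      \<open>y\<close>. The edges left at \<open>g x\<close> and at \<open>g y\<close> meet at the
      merged end, hence have different colours under \<open>d\<close>, which makes both demands on
      \<open>b\<close> compatible.\<close>
    have ex: "\<exists>b. (\<forall>v\<in>W. g v = g x \<longrightarrow> d v \<noteq> b) \<and> (\<forall>v\<in>W. g v = g y \<longrightarrow> d v = b)"
    proof (cases "\<exists>v\<in>W. g v = g x")
      case True
      then obtain v where v: "v \<in> W" "g v = g x" by blast
      have un: "w = v" if "w \<in> W" "g w = g x" for w
        using g2[of w v x] v that W xy by auto
      have "d w \<noteq> d v" if "w \<in> W" "g w = g y" for w
      proof (cases "w = v")
        case True
        with that v have "g x = g y" by simp
        then show ?thesis using g2[of v x y] v W xy by auto
      next
        case False
        then show ?thesis using dh[of w v] v that by (auto simp: h_def)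
      qed
      then show ?thesis using un by (intro exI[of _ "\<not> d v"]) auto
    next
      case False
      have "w = v" if "w \<in> W" "g w = g y" "v \<in> W" "g v = g y" for v w
        using g2[of w v y] that W xy by auto
      then have "\<exists>b. \<forall>v\<in>W. g v = g y \<longrightarrow> d v = b" by metis
      then show ?thesis using False by blast
    qed
    then obtain b where b: "\<And>v. v \<in> W \<Longrightarrow> g v = g x \<Longrightarrow> d v \<noteq> b"
      "\<And>v. v \<in> W \<Longrightarrow> g v = g y \<Longrightarrow> d v = b" by blast
    define c where "c = d(x := b, y := \<not> b)"
    have cW: "c v = d v" if "v \<in> W" for v using that W unfolding c_def by auto
    have c: "c x = b" "c y = (\<not> b)" using xy unfolding c_def by auto
    have "d u \<noteq> d v" if "u \<in> W" "v \<in> W" "u \<noteq> v" "g u = g v" for u v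
      using dh[of u v] that by (simp add: h_def)
    then have "proper_on W g d" unfolding proper_on_def by blast
    then have "proper_on W g c" by (rule proper_on_cong) (simp add: cW)
    moreover have "c v \<noteq> c x" if "v \<in> W" "g v = g x" for v using b(1) c cW that by simp
    moreover have "c v \<noteq> c y" if "v \<in> W" "g v = g y" for v using b(2) c cW that by simp
    ultimately have "proper_on V g c"
      unfolding W(3) proper_on_insert using c by blast
    moreover have "proper_on W f c" using d(1) by (rule proper_on_cong) (simp add: cW)
    \<comment> \<open>\<open>x\<close> and \<open>y\<close> already fill their common end on the
      \<open>f\<close>-side.\<close>
    moreover have "f v \<noteq> f x" "f v \<noteq> f y" if "v \<in> W" for v
    proof -
      have "v \<in> V" "v \<noteq> x" "v \<noteq> y" using that W by auto
      then show "f v \<noteq> f x" "f v \<noteq> f y" using f2[of v x y] xy by metis+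
    qed
    ultimately have "proper_on V f c"
      unfolding W(3) proper_on_insert using c by blast
    with \<open>proper_on V g c\<close> show ?thesis by blast
  qed
qed

section \<open>From two colours to \<open>k\<close> colours\<close>

lemma proper_on_subset: "proper_on V f c \<Longrightarrow> U \<subseteq> V \<Longrightarrow> proper_on U f c"
  unfolding proper_on_def by blast

lemma proper_on_insert_upd:
  assumes "proper_on V f c" "e \<notin> V" "\<And>v. v \<in> V \<Longrightarrow> f v = f e \<Longrightarrow> c v \<noteq> a"
  shows "proper_on (insert e V) f (c(e := a))"
proof -
  have "proper_on V f (c(e := a))"
    using assms(1,2) unfolding proper_on_def by auto
  then show ?thesis using assms(3) by (simp add: proper_on_insert)
qed

text \<open>Each of the two colours occurs at most once at an end.\<close>

lemma degree_le_2_of_two_colors: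
  assumes "finite S" "proper_on S f c" "c ` S \<subseteq> {a, b}"
  shows "degree_le 2 S f"
  unfolding degree_le_2_iff[OF assms(1)]
proof (intro ballI impI)
  fix u v w assume *: "u \<in> S" "v \<in> S" "w \<in> S" "f u = f v \<and> f v = f w"
  then have "c u \<in> {a, b}" "c v \<in> {a, b}" "c w \<in> {a, b}" using assms(3) by auto
  then have "c u = c v \<or> c v = c w \<or> c u = c w" by auto
  with * show "u = v \<or> v = w \<or> u = w" using assms(2) unfolding proper_on_def by metis
qed

text \<open>Edges inside and outside \<open>S\<close> cannot clash, because \<open>a\<close> and
  \<open>b\<close> are absent outside.\<close>

lemma proper_on_recolor:
  assumes "proper_on (V - S) f c" "proper_on S f d" "a \<noteq> b"
    and "\<And>v. v \<in> V - S \<Longrightarrow> c v \<noteq> a \<and> c v \<noteq> b"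
  shows "proper_on V f (\<lambda>v. if v \<in> S then if d v then a else b else c v)"
  unfolding proper_on_def
proof (intro ballI impI)
  fix u v assume *: "u \<in> V" "v \<in> V" "u \<noteq> v \<and> f u = f v"
  have "d u \<noteq> d v" if "u \<in> S" "v \<in> S" using assms(2) * that unfolding proper_on_def by blast
  moreover have "c u \<noteq> c v" if "u \<notin> S" "v \<notin> S"
    using assms(1) * that unfolding proper_on_def by blast
  ultimately show "(if u \<in> S then if d u then a else b else c u) \<noteq>
      (if v \<in> S then if d v then a else b else c v)"
    using assms(3) assms(4)[of u] assms(4)[of v] * by auto
qed

text \<open>The uncoloured edge \<open>e\<close> takes one of the at most \<open>k\<close> places at
  its end, leaving at most \<open>k - 1\<close> colours in use there.\<close>

lemma missing_color:
  assumes "finite V" "e \<notin> V" "degree_le k (insert e V) f" "c \<in> V \<rightarrow> {..<k}"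
  obtains a where "a < k" "\<And>v. v \<in> V \<Longrightarrow> f v = f e \<Longrightarrow> c v \<noteq> a"
proof -
  let ?F = "{v\<in>V. f v = f e}"
  have "{v\<in>insert e V. f v = f e} = insert e ?F" by auto
  then have "card (insert e ?F) \<le> k" using assms(3) unfolding degree_le_def by metis
  then have "card ?F < k" using assms(1,2) by simp
  then have "card (c ` ?F) < k" using card_image_le[of ?F c] assms(1) by simp
  then have "\<not> {..<k} \<subseteq> c ` ?F"
    using card_mono[of "c ` ?F" "{..<k}"] assms(1) by auto
  then obtain a where "a < k" "a \<notin> c ` ?F" by auto
  then show ?thesis using that by blast
qed

text \<open>Koenig's theorem. Adding the edge \<open>e\<close>, let colour \<open>a\<close> be free at one end and \<open>b\<close> at the other.
  The edges coloured \<open>a\<close> or \<open>b\<close> together with \<open>e\<close> have maximum degree 2 and are recoloured.\<close>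

lemma bipartite_edge_coloring:
  fixes f :: "'a \<Rightarrow> 'b" and g :: "'a \<Rightarrow> 'c"
  assumes "finite V" "degree_le k V f" "degree_le k V g"
  shows "\<exists>c \<in> V \<rightarrow> {..<k}. proper_on V f c \<and> proper_on V g c"
  using assms
proof (induction V rule: finite_induct)
  case empty
  then show ?case by (auto simp: proper_on_def)
next
  case (insert e V)
  have "degree_le k V f" "degree_le k V g"
    using insert.prems insert.hyps by (auto intro: degree_le_subset[of k "insert e V"])
  then obtain c where c: "c \<in> V \<rightarrow> {..<k}" "proper_on V f c" "proper_on V g c"
    using insert.IH by blast
  obtain a where a: "a < k" "\<And>v. v \<in> V \<Longrightarrow> f v = f e \<Longrightarrow> c v \<noteq> a"
    using missing_color insert c(1) by metis
  obtain b where b: "b < k" "\<And>v. v \<in> V \<Longrightarrow> g v = g e \<Longrightarrow> c v \<noteq> b"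
    using missing_color insert c(1) by metis
  define U where "U = {v\<in>V. c v = a \<or> c v = b}"
  define S where "S = insert e U"
  have U: "finite U" "e \<notin> U" "finite S" "U \<subseteq> V" using insert.hyps unfolding U_def S_def by auto
  have upd: "proper_on (insert e V) f (c(e := a))" "proper_on (insert e V) g (c(e := b))"
    using proper_on_insert_upd[OF c(2) insert.hyps(2) a(2)]
      proper_on_insert_upd[OF c(3) insert.hyps(2) b(2)] by blast+
  moreover have "S \<subseteq> insert e V" unfolding S_def using U(4) by blast
  ultimately have S: "proper_on S f (c(e := a))" "proper_on S g (c(e := b))"
    by (blast intro: proper_on_subset)+
  have ab: "(c(e := a)) ` S \<subseteq> {a, b}" "(c(e := b)) ` S \<subseteq> {a, b}"
    unfolding S_def U_def by auto
  \<comment> \<open>Colouring \<open>e\<close> with \<open>a\<close> is proper at the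
    \<open>f\<close>-ends, with \<open>b\<close> at the \<open>g\<close>-ends. The two colourings
    may differ, but each bounds the degree on its own side.\<close>
  have deg: "degree_le 2 S f" "degree_le 2 S g"
    using degree_le_2_of_two_colors[OF U(3) S(1) ab(1)]
      degree_le_2_of_two_colors[OF U(3) S(2) ab(2)] by blast+
  obtain d :: "'a \<Rightarrow> bool" where d: "proper_on S f d" "proper_on S g d"
    using bipartite_two_edge_coloring[OF U(3) deg] by blast
  define c' where "c' v = (if v \<in> S then if d v then a else b else c v)" for v
  have range: "c' \<in> insert e V \<rightarrow> {..<k}"
    using a(1) b(1) c(1) unfolding c'_def S_def by (auto simp: Pi_iff)
  show ?case
  proof (cases "a = b")
    case True
    \<comment> \<open>A colour free at both ends of \<open>e\<close> serves \<open>e\<close>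
      directly.\<close>
    have "c(e := a) \<in> insert e V \<rightarrow> {..<k}" using c a by auto
    with upd True show ?thesis by blast
  next
    case False
    have rest: "c v \<noteq> a \<and> c v \<noteq> b" if "v \<in> insert e V - S" for v
      using that unfolding S_def U_def by auto
    have "insert e V - S \<subseteq> V" unfolding S_def by blast
    then have "proper_on (insert e V - S) f c" "proper_on (insert e V - S) g c"
      using c(2,3) by (blast intro: proper_on_subset)+
    then have "proper_on (insert e V) f c'" "proper_on (insert e V) g c'"
      unfolding c'_def using proper_on_recolor[OF _ d(1) False] proper_on_recolor[OF _ d(2) False] rest
      by blast+
    with range show ?thesis by blast
  qed
qed

section \<open>The upper bound\<close>

text \<open>Points may share a coordinate, so ties are broken by the position in a sorted list. The
  weak implication from ranks to values is what makes strips convex in the ranks.\<close>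

lemma monotone_ranking:
  fixes f :: "'a \<Rightarrow> 'b::linorder"
  assumes "finite V"
  obtains r where "bij_betw r V {..<card V}"
    "\<And>u v. u \<in> V \<Longrightarrow> v \<in> V \<Longrightarrow> r u \<le> r v \<Longrightarrow> f u \<le> f v"
proof -
  obtain ys where ys: "set ys = V" "distinct ys" using assms finite_distinct_list by blast
  define xs where "xs = sort_key f ys"
  have xs: "set xs = V" "distinct xs" "sorted (map f xs)"
    using ys unfolding xs_def by auto
  have n: "length xs = card V" using xs distinct_card by metis
  have bij: "bij_betw ((!) xs) {..<card V} V"
    using bij_betw_nth[OF xs(2)] n xs(1) by auto
  define r where "r = the_inv_into {..<card V} ((!) xs)"
  have r: "bij_betw r V {..<card V}" unfolding r_def using bij by (rule bij_betw_the_inv_into)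
  have inv: "xs ! r v = v" "r v < length xs" if "v \<in> V" for v
    using that bij r n unfolding r_def
    by (auto simp: f_the_inv_into_f_bij_betw bij_betw_def dest: bij_betwE)
  have "f u \<le> f v" if "u \<in> V" "v \<in> V" "r u \<le> r v" for u v
    using sorted_nth_mono[OF xs(3) that(3)] inv that by simp
  with r show ?thesis using that by blast
qed

text \<open>From the minimum \<open>s\<close>, the next multiple of \<open>k\<close> is at most
  \<open>s + k - 1\<close>, so its block ends by \<open>s + 2 * k - 2\<close>, which the maximum
  reaches.\<close>

lemma convex_nat_set_contains_block:
  fixes I :: "nat set"
  assumes "finite I" "2 * k - 1 \<le> card I" "k > 0"
    and conv: "\<And>i j l. i \<in> I \<Longrightarrow> l \<in> I \<Longrightarrow> i \<le> j \<Longrightarrow> j \<le> l \<Longrightarrow> j \<in> I"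
  shows "\<exists>q. {i. i div k = q} \<subseteq> I"
proof -
  have ne: "I \<noteq> {}" using assms by auto
  define s where "s = Min I"
  define t where "t = Max I"
  have st: "s \<in> I" "t \<in> I" "I \<subseteq> {s..t}" using assms(1) ne unfolding s_def t_def by auto
  have "card I \<le> card {s..t}" using st by (intro card_mono) auto
  then have len: "s + (2 * k - 1) \<le> t + 1" using assms(2,3) by simp
  \<comment> \<open>\<open>s / k\<close> rounded up.\<close>
  define q where "q = (s + k - 1) div k"
  have "q * k + (s + k - 1) mod k = s + k - 1" unfolding q_def by (rule div_mult_mod_eq)
  moreover have "(s + k - 1) mod k < k" using assms(3) by simp
  ultimately have q: "s \<le> q * k" "q * k \<le> s + k - 1" by linarith+
  have "i \<in> I" if "i div k = q" for i
  proof -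
    have "q * k + i mod k = i" using that by (metis div_mult_mod_eq)
    moreover have "i mod k < k" using assms(3) by simp
    ultimately have "s \<le> i" "i \<le> t" using q len assms(3) by linarith+
    then show ?thesis using conv st by blast
  qed
  then show ?thesis by blast
qed

text \<open>\<open>f\<close> stands for either coordinate. Blocks are runs of \<open>k\<close>
  consecutive ranks, and a strip occupies a convex set of ranks.\<close>

lemma block_partition:
  fixes f :: "'a \<Rightarrow> 'b::linorder"
  assumes fin: "finite V" and k: "k > 0"
  shows "\<exists>\<beta> :: 'a \<Rightarrow> nat. degree_le k V \<beta> \<and>
    (\<forall>a b. 2 * k - 1 \<le> card {v\<in>V. a < f v \<and> f v < b} \<longrightarrow>
       (\<exists>j. card {v\<in>V. \<beta> v = j} = k \<and> (\<forall>v\<in>V. \<beta> v = j \<longrightarrow> a < f v \<and> f v < b)))"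
proof -
  obtain r where r: "bij_betw r V {..<card V}"
    and mono: "\<And>u v. u \<in> V \<Longrightarrow> v \<in> V \<Longrightarrow> r u \<le> r v \<Longrightarrow> f u \<le> f v"
    using monotone_ranking[OF fin, of f] by blast
  have inj: "inj_on r V" and img: "r ` V = {..<card V}" using r by (auto simp: bij_betw_def)
  define \<beta> where "\<beta> v = r v div k" for v
  have block: "{i. i div k = j} = {j * k..<j * k + k}" for j
  proof -
    have "i div k = j \<longleftrightarrow> j * k \<le> i \<and> i < j * k + k" for i
      using div_nat_eqI[of k j i] k dividend_less_times_div[of k i] times_div_less_eq_dividend[of k i]
      by (auto simp: algebra_simps)
    then show ?thesis unfolding set_eq_iff mem_Collect_eq atLeastLessThan_iff by blast
  qed
  have img': "r ` {v\<in>V. \<beta> v = j} = {i. i div k = j} \<inter> {..<card V}" for j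
    using img unfolding \<beta>_def by auto
  have card_block: "card {v\<in>V. \<beta> v = j} = card ({i. i div k = j} \<inter> {..<card V})" for j
    using img'[of j] card_image[OF inj_on_subset[OF inj, of "{v\<in>V. \<beta> v = j}"]] by auto
  have "card {v\<in>V. \<beta> v = j} \<le> k" for j
    unfolding card_block block
    using card_mono[of "{j * k..<j * k + k}" "{j * k..<j * k + k} \<inter> {..<card V}"] by simp
  then have deg: "degree_le k V \<beta>" unfolding degree_le_def by blast
  have "\<exists>j. card {v\<in>V. \<beta> v = j} = k \<and> (\<forall>v\<in>V. \<beta> v = j \<longrightarrow> a < f v \<and> f v < b)"
    if large: "2 * k - 1 \<le> card {v\<in>V. a < f v \<and> f v < b}" for a b
  proof -
    let ?e = "{v\<in>V. a < f v \<and> f v < b}"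
    have card_e: "card (r ` ?e) = card ?e"
      by (intro card_image inj_on_subset[OF inj]) auto
    have conv: "j \<in> r ` ?e" if ijl: "i \<in> r ` ?e" "l \<in> r ` ?e" "i \<le> j" "j \<le> l" for i j l
    proof -
      obtain u w where uw: "u \<in> ?e" "w \<in> ?e" "i = r u" "l = r w" using ijl by blast
      then have "r w < card V" using img by auto
      then have "j \<in> r ` V" using ijl uw img by auto
      then obtain v where v: "v \<in> V" "j = r v" by blast
      then have "f u \<le> f v" "f v \<le> f w" using mono ijl uw by auto
      then show ?thesis using uw v by auto
    qed
    have "finite (r ` ?e)" "2 * k - 1 \<le> card (r ` ?e)" using fin large card_e by simp_all
    then have "\<exists>q. {i. i div k = q} \<subseteq> r ` ?e"
      using k conv by (rule convex_nat_set_contains_block)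
    then obtain q where q: "{i. i div k = q} \<subseteq> r ` ?e" ..
    \<comment> \<open>The last block may be incomplete; this one consists entirely of ranks of
      points and is therefore full.\<close>
    have "{i. i div k = q} \<inter> {..<card V} = {i. i div k = q}" using q img by auto
    then have "card {v\<in>V. \<beta> v = q} = k" using card_block[of q] block[of q] by simp
    moreover have "a < f v \<and> f v < b" if "v \<in> V" "\<beta> v = q" for v
    proof -
      have "r v \<in> r ` ?e" using q that unfolding \<beta>_def by auto
      then show ?thesis using inj that by (auto dest: inj_onD)
    qed
    ultimately show ?thesis by blast
  qed
  with deg show ?thesis by blast
qed

text \<open>\<open>k\<close> points with pairwise different colours exhaust the \<open>k\<close>
  colours.\<close>

lemma full_block_all_colors:
  assumes "proper_on V \<beta> c" "c \<in> V \<rightarrow> {..<k}" "card {v\<in>V. \<beta> v = j} = k" "i < k"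
  obtains v where "v \<in> V" "\<beta> v = j" "c v = i"
proof -
  let ?B = "{v\<in>V. \<beta> v = j}"
  have "inj_on c ?B" using assms(1) unfolding proper_on_def inj_on_def by (auto; metis)
  then have "card (c ` ?B) = card {..<k}" using assms(3) by (simp add: card_image)
  moreover have "c ` ?B \<subseteq> {..<k}" using assms(2) by auto
  ultimately have "c ` ?B = {..<k}" by (intro card_subset_eq) auto
  then have "i \<in> c ` ?B" using assms(4) by simp
  then show ?thesis using that by blast
qed

lemma polychromatic_bound_strip_union:
  assumes k: "k > 0"
  shows "polychromatic_bound strip_union_family k (4 * k - 3)"
  unfolding polychromatic_bound_def
proof (intro conjI ballI)
  show "0 < 4 * k - 3" using k by simp
  fix H assume "H \<in> strip_union_family"
  then obtain V E where H: "H = (V, E)" "finite V"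
    and E: "\<forall>e\<in>E. \<exists>x0 x1 y0 y1. e = V \<inter> (horizontal_strip y0 y1 \<union> vertical_strip x0 x1)"
    unfolding strip_union_family_def by auto
  obtain \<xi> :: "real \<times> real \<Rightarrow> nat" where \<xi>: "degree_le k V \<xi>"
    "\<forall>a b. 2 * k - 1 \<le> card {v\<in>V. a < fst v \<and> fst v < b} \<longrightarrow>
       (\<exists>j. card {v\<in>V. \<xi> v = j} = k \<and> (\<forall>v\<in>V. \<xi> v = j \<longrightarrow> a < fst v \<and> fst v < b))"
    using block_partition[OF H(2) k, of fst] by blast
  obtain \<upsilon> :: "real \<times> real \<Rightarrow> nat" where \<upsilon>: "degree_le k V \<upsilon>"
    "\<forall>a b. 2 * k - 1 \<le> card {v\<in>V. a < snd v \<and> snd v < b} \<longrightarrow>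
       (\<exists>j. card {v\<in>V. \<upsilon> v = j} = k \<and> (\<forall>v\<in>V. \<upsilon> v = j \<longrightarrow> a < snd v \<and> snd v < b))"
    using block_partition[OF H(2) k, of snd] by blast
  obtain c where c: "c \<in> V \<rightarrow> {..<k}" "proper_on V \<xi> c" "proper_on V \<upsilon> c"
    using bipartite_edge_coloring[OF H(2) \<xi>(1) \<upsilon>(1)] by blast
  have "\<exists>v\<in>e. c v = i" if e: "e \<in> E" "4 * k - 3 \<le> card e" and i: "i < k" for e i
  proof -
    obtain x0 x1 y0 y1 where eq: "e = V \<inter> (horizontal_strip y0 y1 \<union> vertical_strip x0 x1)"
      using bspec[OF E e(1)] by (elim exE)
    let ?h = "{v\<in>V. y0 < snd v \<and> snd v < y1}" and ?v = "{v\<in>V. x0 < fst v \<and> fst v < x1}"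
    have eq': "e = ?h \<union> ?v"
      unfolding eq horizontal_strip_def vertical_strip_def by auto
    have "card e \<le> card ?h + card ?v" unfolding eq' by (rule card_Un_le)
    \<comment> \<open>Otherwise both strips have at most \<open>2 * k - 2\<close> points, giving at
      most \<open>4 * k - 4\<close> in the union.\<close>
    then have "2 * k - 1 \<le> card ?h \<or> 2 * k - 1 \<le> card ?v" using e by linarith
    then show ?thesis
    proof
      assume "2 * k - 1 \<le> card ?h"
      then obtain j where j: "card {v\<in>V. \<upsilon> v = j} = k"
        "\<forall>v\<in>V. \<upsilon> v = j \<longrightarrow> y0 < snd v \<and> snd v < y1"
        using \<upsilon>(2)[rule_format, of y0 y1] by blast
      obtain v where v: "v \<in> V" "\<upsilon> v = j" "c v = i"
        using full_block_all_colors[OF c(3,1) j(1) i] .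
      then have "v \<in> e" unfolding eq' using j(2) by simp
      with v(3) show ?thesis by blast
    next
      assume "2 * k - 1 \<le> card ?v"
      then obtain j where j: "card {v\<in>V. \<xi> v = j} = k"
        "\<forall>v\<in>V. \<xi> v = j \<longrightarrow> x0 < fst v \<and> fst v < x1"
        using \<xi>(2)[rule_format, of x0 x1] by blast
      obtain v where v: "v \<in> V" "\<xi> v = j" "c v = i"
        using full_block_all_colors[OF c(2,1) j(1) i] .
      then have "v \<in> e" unfolding eq' using j(2) by simp
      with v(3) show ?thesis by blast
    qed
  qed
  then show "\<exists>c. polychromatic_coloring k (restrict_edges (4 * k - 3) H) c"
    using c(1) unfolding polychromatic_coloring_def restrict_edges_def H(1) by auto
qed

section \<open>The lower bound\<close>

text \<open>The vertical order of eight groups whose horizontal order is \<open>0, \<dots>, 7\<close>. Any two of the first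
  four groups, and any two of the last four, are consecutive in one of the two orders.\<close>

definition group_row :: "nat \<Rightarrow> nat" where
  "group_row g = [2, 0, 3, 1, 6, 4, 7, 5] ! g"

text \<open>Each group lies on the diagonal of a unit cell. The shift \<open>j + 2\<close> keeps the
  offset strictly between 0 and 1, so strips with integer bounds contain a group entirely or not at
  all.\<close>

definition group_point :: "nat \<Rightarrow> nat \<Rightarrow> real \<times> real" where
  "group_point g j = (real g + 1 / real (j + 2), real (group_row g) + 1 / real (j + 2))"

lemma less_8_cases: "g < 8 \<longleftrightarrow> g \<in> {0, 1, 2, 3, 4, 5, 6, 7::nat}"
  by auto

lemma group_row_eq_iff:
  assumes "g < 8" "h < 8"
  shows "group_row g = group_row h \<longleftrightarrow> g = h"
  using assms unfolding less_8_cases group_row_def by auto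

text \<open>Columns give the pairs 01, 12, 23 and rows the pairs 13, 03, 02: a path on four vertices
  and its complement, again a path. The last four groups repeat the pattern shifted by 4.\<close>

lemma consecutive_groups:
  assumes "a < 8" "b < 8" "a \<noteq> b" "a < 4 \<longleftrightarrow> b < 4"
  shows "a = Suc b \<or> b = Suc a \<or> group_row a = Suc (group_row b) \<or> group_row b = Suc (group_row a)"
  using assms unfolding less_8_cases group_row_def by auto

lemma add_fraction_between_iff:
  "real m < real n + 1 / real (j + 2) \<and> real n + 1 / real (j + 2) < real l \<longleftrightarrow> m \<le> n \<and> n < l"
proof -
  have t: "0 < 1 / real (j + 2)" "1 / real (j + 2) < 1" by auto
  have "real m < real n + 1 / real (j + 2) \<longleftrightarrow> m \<le> n"
  proof
    assume "real m < real n + 1 / real (j + 2)"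
    then have "real m < real n + 1" using t by linarith
    then show "m \<le> n" by linarith
  qed (use t in linarith)
  moreover have "real n + 1 / real (j + 2) < real l \<longleftrightarrow> n < l"
  proof
    assume "real n + 1 / real (j + 2) < real l"
    then have "real n < real l" using t by linarith
    then show "n < l" by simp
  next
    assume "n < l"
    then have "real n + 1 \<le> real l" by linarith
    then show "real n + 1 / real (j + 2) < real l" using t by linarith
  qed
  ultimately show ?thesis by simp
qed

lemma group_point_mem_vertical_strip:
  "group_point g j \<in> vertical_strip (real m) (real l) \<longleftrightarrow> m \<le> g \<and> g < l"
  unfolding group_point_def vertical_strip_def using add_fraction_between_iff by simp

lemma group_point_mem_horizontal_strip:
  "group_point g j \<in> horizontal_strip (real m) (real l) \<longleftrightarrow> m \<le> group_row g \<and> group_row g < l"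
  unfolding group_point_def horizontal_strip_def using add_fraction_between_iff by simp

lemma group_point_eq_iff: "group_point g j = group_point h i \<longleftrightarrow> g = h \<and> j = i"
proof
  assume eq: "group_point g j = group_point h i"
  have "group_point g j \<in> vertical_strip (real g) (real (Suc g))"
    by (simp only: group_point_mem_vertical_strip) simp
  then have "group_point h i \<in> vertical_strip (real g) (real (Suc g))" using eq by simp
  then have "g = h" by (simp only: group_point_mem_vertical_strip) simp
  with eq show "g = h \<and> j = i" by (auto simp: group_point_def)
qed simp

definition eight_groups :: "nat \<Rightarrow> (real \<times> real) set" where
  "eight_groups p = case_prod group_point ` ({..<8} \<times> {..<p})"

definition strip_union_trace :: "(real \<times> real) set \<Rightarrow> (real \<times> real) set \<Rightarrow> bool" where
  "strip_union_trace V e \<longleftrightarrow>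
    (\<exists>x0 x1 y0 y1. e = V \<inter> (horizontal_strip y0 y1 \<union> vertical_strip x0 x1))"

lemma three_groups_trace:
  assumes S: "S \<subseteq> {..<8}" "3 \<le> card S"
  obtains T where "T \<subseteq> S" "card T = 3"
    "strip_union_trace (eight_groups p) (case_prod group_point ` (T \<times> {..<p}))"
proof -
  have fin: "finite S" using S finite_subset by auto
  have "S = {g\<in>S. g < 4} \<union> {g\<in>S. \<not> g < 4}" by auto
  then have "card S \<le> card {g\<in>S. g < 4} + card {g\<in>S. \<not> g < 4}" by (metis card_Un_le)
  then have "2 \<le> card {g\<in>S. g < 4} \<or> 2 \<le> card {g\<in>S. \<not> g < 4}" using S by linarith
  \<comment> \<open>Pigeonhole over the two halves; \<open>P\<close> records which half contains two
    groups of \<open>S\<close>.\<close>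
  then obtain P where "2 \<le> card {g\<in>S. g < 4 \<longleftrightarrow> P}"
    using that[of True] that[of False] by auto
  then obtain B where B: "B \<subseteq> {g\<in>S. g < 4 \<longleftrightarrow> P}" "card B = 2"
    by (meson obtain_subset_with_card_n)
  then obtain a b where "B = {a, b}" "a \<noteq> b" by (auto simp: card_2_iff)
  with B have ab: "a \<in> S" "b \<in> S" "a \<noteq> b" "a < 4 \<longleftrightarrow> b < 4" by auto
  have "\<not> S \<subseteq> {a, b}" using S(2) card_mono[of "{a, b}" S] ab(3) by auto
  then obtain c where c: "c \<in> S" "c \<noteq> a" "c \<noteq> b" by blast
  have lt: "a < 8" "b < 8" "c < 8" using ab c S by auto
  define e where "e = case_prod group_point ` ({a, b, c} \<times> {..<p})"
  have mem: "(v \<in> e) \<longleftrightarrow> (\<exists>g<8. \<exists>j<p. v = group_point g j \<and> g \<in> {a, b, c})" for v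
    using lt unfolding e_def by force
  have trace: "e = eight_groups p \<inter> A"
    if "\<And>g j. g < 8 \<Longrightarrow> group_point g j \<in> A \<longleftrightarrow> g \<in> {a, b, c}" for A
    using that mem unfolding eight_groups_def by (auto; blast)
  note mem_strip = group_point_mem_vertical_strip group_point_mem_horizontal_strip
  have "strip_union_trace (eight_groups p) e"
  proof -
    consider "a = Suc b \<or> b = Suc a" | "group_row a = Suc (group_row b) \<or> group_row b = Suc (group_row a)"
      using consecutive_groups[OF lt(1,2) ab(3,4)] by blast
    then show ?thesis
    proof cases
      case 1
      \<comment> \<open>A window of width 2 starting at the smaller index holds exactly the two
        consecutive groups, and a unit window across it holds \<open>c\<close>.\<close>
      let ?m = "min a b" and ?r = "group_row c"
      have "group_point g j \<in> horizontal_strip (real ?r) (real (Suc ?r)) \<union>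
          vertical_strip (real ?m) (real (?m + 2)) \<longleftrightarrow> g \<in> {a, b, c}" if "g < 8" for g j
      proof -
        have "?r \<le> group_row g \<and> group_row g < Suc ?r \<longleftrightarrow> g = c"
          using group_row_eq_iff[of g c] that lt by auto
        moreover have "?m \<le> g \<and> g < ?m + 2 \<longleftrightarrow> g = a \<or> g = b" using 1 by auto
        ultimately show ?thesis unfolding Un_iff mem_strip by blast
      qed
      from trace[OF this] show ?thesis unfolding strip_union_trace_def by blast
    next
      case 2
      let ?m = "min (group_row a) (group_row b)"
      have "group_point g j \<in> horizontal_strip (real ?m) (real (?m + 2)) \<union>
          vertical_strip (real c) (real (Suc c)) \<longleftrightarrow> g \<in> {a, b, c}" if "g < 8" for g j
      proof -
        have "?m \<le> group_row g \<and> group_row g < ?m + 2 \<longleftrightarrow>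
            group_row g = group_row a \<or> group_row g = group_row b" using 2 by auto
        then have "?m \<le> group_row g \<and> group_row g < ?m + 2 \<longleftrightarrow> g = a \<or> g = b"
          using group_row_eq_iff that lt by auto
        moreover have "c \<le> g \<and> g < Suc c \<longleftrightarrow> g = c" by auto
        ultimately show ?thesis unfolding Un_iff mem_strip by blast
      qed
      from trace[OF this] show ?thesis unfolding strip_union_trace_def by blast
    qed
  qed
  moreover have "card {a, b, c} = 3" using ab c by auto
  ultimately show ?thesis using that[of "{a, b, c}"] ab c unfolding e_def by blast
qed

text \<open>Double counting of pairs of a group and a colour it misses: there are at least
  \<open>8 * (k - p)\<close> of them, which exceeds \<open>2 * k\<close> by
  \<open>4 * p < 3 * k\<close>.\<close>

lemma color_missed_by_three_sets:
  fixes D :: "nat \<Rightarrow> nat set"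
  assumes "\<And>g. g < 8 \<Longrightarrow> finite (D g) \<and> card (D g) \<le> p" "4 * p < 3 * k"
  shows "\<exists>i<k. 3 \<le> card {g\<in>{..<8}. i \<notin> D g}"
proof (rule ccontr)
  assume no: "\<not> ?thesis"
  have le: "card {g\<in>{..<8}. i \<notin> D g} \<le> 2" if "i < k" for i
    using no that by force
  have "(\<Sum>i<k. card {g\<in>{..<8}. i \<notin> D g}) = (\<Sum>i<k. \<Sum>g<8. of_bool (i \<notin> D g))"
    by (intro sum.cong) (auto simp: sum.If_cases of_bool_def Int_def)
  also have "\<dots> = (\<Sum>g<8. \<Sum>i<k. of_bool (i \<notin> D g))" by (rule sum.swap)
  also have "\<dots> = (\<Sum>g<8. card ({..<k} - D g))"
    by (intro sum.cong refl) (auto simp: sum.If_cases of_bool_def set_diff_eq Int_def)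
  also have "\<dots> \<ge> (\<Sum>g<(8::nat). k - p)"
  proof (intro sum_mono)
    fix g :: nat assume "g \<in> {..<8}"
    then have "card {..<k} - card (D g) \<le> card ({..<k} - D g)" "card (D g) \<le> p"
      using assms(1) diff_card_le_card_Diff[of "D g" "{..<k}"] by auto
    then show "k - p \<le> card ({..<k} - D g)" by simp
  qed
  finally have "8 * (k - p) \<le> (\<Sum>i<k. card {g\<in>{..<8}. i \<notin> D g})" by simp
  also have "\<dots> \<le> (\<Sum>i<k. 2)" using le by (intro sum_mono) auto
  finally show False using assms(2) by simp
qed

text \<open>Covering every \<open>m\<close> up to \<open>3 * p\<close> lets this apply directly to
  the least bound. For \<open>p = 0\<close> the offending edge is empty.\<close>

lemma not_polychromatic_bound_strip_union:
  assumes "4 * p < 3 * k" "m \<le> 3 * p"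
  shows "\<not> polychromatic_bound strip_union_family k m"
proof
  assume bound: "polychromatic_bound strip_union_family k m"
  let ?V = "eight_groups p"
  let ?H = "(?V, {e. strip_union_trace ?V e})"
  have "?H \<in> strip_union_family"
    unfolding strip_union_family_def strip_union_trace_def by (auto simp: eight_groups_def)
  then obtain c where c: "polychromatic_coloring k (restrict_edges m ?H) c"
    using bound unfolding polychromatic_bound_def by blast
  define D where "D g = (\<lambda>j. c (group_point g j)) ` {..<p}" for g
  have "finite (D g) \<and> card (D g) \<le> p" for g
    unfolding D_def using card_image_le[of "{..<p}"] by auto
  then obtain i where i: "i < k" "3 \<le> card {g\<in>{..<8}. i \<notin> D g}"
    using color_missed_by_three_sets[of D p k] assms(1) by blast
  obtain T where T: "T \<subseteq> {g\<in>{..<8}. i \<notin> D g}" "card T = 3"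
    "strip_union_trace ?V (case_prod group_point ` (T \<times> {..<p}))"
    using three_groups_trace[OF _ i(2)] by blast
  let ?e = "case_prod group_point ` (T \<times> {..<p})"
  have "card ?e = card (T \<times> {..<p})"
    by (intro card_image) (auto simp: inj_on_def group_point_eq_iff)
  \<comment> \<open>The edge has exactly \<open>3 * p\<close> points and so survives the deletion of
    small edges.\<close>
  then have "m \<le> card ?e" using T(2) assms(2) by (simp add: card_cartesian_product)
  then have "?e \<in> snd (restrict_edges m ?H)" using T(3) unfolding restrict_edges_def by simp
  then obtain v where "v \<in> ?e" "c v = i"
    using c i(1) unfolding polychromatic_coloring_def by blast
  then show False using T(1) unfolding D_def by auto
qed

theorem theorem4:
  fixes k :: nat
  assumes "k > 0"
  shows "enat (nat (3 * \<lceil>3 / 4 * real k\<rceil> - 2)) \<le> polychromatic_number strip_union_family k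
       \<and> polychromatic_number strip_union_family k \<le> enat (4 * k - 3)"
proof
  note upper = polychromatic_bound_strip_union[OF assms]
  define L where "L = (LEAST m. polychromatic_bound strip_union_family k m)"
  \<comment> \<open>The upper bound rules out the value infinity.\<close>
  have num: "polychromatic_number strip_union_family k = enat L"
    using upper unfolding polychromatic_number_def L_def by auto
  show "polychromatic_number strip_union_family k \<le> enat (4 * k - 3)"
    unfolding num L_def using Least_le[of "polychromatic_bound strip_union_family k", OF upper] by simp
  have L: "polychromatic_bound strip_union_family k L"
    unfolding L_def using upper by (rule LeastI)
  \<comment> \<open>The largest natural number strictly below \<open>3 / 4 * k\<close>; the ceiling
    is positive, so \<open>nat\<close> truncates nothing.\<close>
  define p where "p = nat (\<lceil>3 / 4 * real k\<rceil> - 1)"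
  have "\<lceil>3 / 4 * real k\<rceil> > 0" using assms by simp
  then have p: "int p = \<lceil>3 / 4 * real k\<rceil> - 1" unfolding p_def by simp
  have "real_of_int (\<lceil>3 / 4 * real k\<rceil> - 1) < 3 / 4 * real k" by linarith
  then have "real p < 3 / 4 * real k" using p by (metis of_int_of_nat_eq)
  then have "4 * p < 3 * k" by linarith
  \<comment> \<open>Strictness supplies the last unit: \<open>3 * p + 1\<close> is the claimed lower
    bound.\<close>
  then have "3 * p < L" using not_polychromatic_bound_strip_union[of p k L] L by (meson not_less)
  then show "enat (nat (3 * \<lceil>3 / 4 * real k\<rceil> - 2)) \<le> polychromatic_number strip_union_family k"
    unfolding num using p by simp
qed

end
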